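(* Let $k\ge 2$, $n\ge 2$, and $2\le m\le|\mathbf{Neck}_k(n)|$. Let $\alpha_1,\alpha_2,\ldots,\alpha_m$ be the last $m$ strings of $\mathbf{Neck}_k(n)$ when it is listed in lexicographic order. Then $\text{UC}(\alpha_1,\ldots,\alpha_m)=pr(\alpha_1)pr(\alpha_2)\cdots pr(\alpha_m)$ is a universal cycle for $\mathbf{S}=\bigcup_{i=1}^m\mathbf{sub}_n(\alpha_i)$.
   Context: $\Sigma_k=\{0,1,\ldots,k-1\}$ with the natural order; $\Sigma_k^n$ is the set of strings of length $n$ over $\Sigma_k$. A necklace is a string that is lexicographically smallest among all its rotations; $\mathbf{Neck}_k(n)$ is the set of $k$-ary necklaces of length $n$. Lexicographic order on strings of equal length: $a_1\cdots a_n$ precedes $b_1\cdots b_n$ if $a_i<b_i$ at the smallest $i$ with $a_i\ne b_i$. The periodic reduction $pr(a_1\cdots a_n)$ is $a_1\cdots a_p$ where $p$ is the smallest integer with $a_1\cdots a_n=(a_1\cdots a_p)^{n/p}$. For a string $\alpha$, $\mathbf{sub}_n(\alpha)$ is the set of all length-$n$ substrings of $\alpha$ viewed as a cyclic string (windows may wrap around). For a nonempty $\mathbf{S}\subseteq\Sigma_k^n$, a universal cycle for $\mathbf{S}$ is a string of length $|\mathbf{S}|$ which, viewed cyclically, contains every string of $\mathbf{S}$ as a length-$n$ substring exactly once. *)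

theory Defs
  imports "HOL-Library.List_Lexorder"
begin

text \<open>Strings are lists of naturals. The order \<open>\<le>\<close> on them is the library's lexicographic
  order (in which a proper prefix is smaller), used below only on lists of equal length.\<close>

definition strings :: "nat \<Rightarrow> nat \<Rightarrow> nat list set" where
  "strings k n = {w. length w = n \<and> set w \<subseteq> {0..<k}}"

definition necklace :: "nat list \<Rightarrow> bool" where
  "necklace w \<longleftrightarrow> (\<forall>i. w \<le> rotate i w)"

definition Neck :: "nat \<Rightarrow> nat \<Rightarrow> nat list set" where
  "Neck k n = {w \<in> strings k n. necklace w}"

definition pr :: "nat list \<Rightarrow> nat list" where
  "pr w = take (LEAST p. 0 < p \<and> p dvd length w \<and>
                  w = concat (replicate (length w div p) (take p w))) w"

definition cyclic_window :: "nat \<Rightarrow> nat list \<Rightarrow> nat \<Rightarrow> nat list" where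
  "cyclic_window n w i = map (\<lambda>j. w ! ((i + j) mod length w)) [0..<n]"

definition sub :: "nat \<Rightarrow> nat list \<Rightarrow> nat list set" where
  "sub n w = {cyclic_window n w i | i. i < length w}"

definition universal_cycle :: "nat \<Rightarrow> nat \<Rightarrow> nat list set \<Rightarrow> nat list \<Rightarrow> bool" where
  "universal_cycle k n S u \<longleftrightarrow>
     S \<noteq> {} \<and> S \<subseteq> strings k n \<and> length u = card S \<and>
     (\<forall>s\<in>S. \<exists>!i. i < length u \<and> cyclic_window n u i = s)"

definition UC :: "nat list list \<Rightarrow> nat list" where
  "UC \<alpha>s = concat (map pr \<alpha>s)"

lemma finite_strings: "finite (strings k n)"
  unfolding strings_def
  by (rule finite_subset[OF _ finite_lists_length_eq[of "{0..<k}" n]]) auto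

lemma finite_Neck: "finite (Neck k n)"
  unfolding Neck_def using finite_strings by simp

end

theory Submission
  imports Defs "HOL-Library.Sublist"
begin

text \<open>If two cyclic words agree on their first \<open>n - 1\<close> letters, their concatenation has exactly the
  windows of length \<open>n\<close> of both. Write \<open>M\<close> for the largest letter and prepend the necklaces one at a
  time, the smallest last. A necklace other than \<open>M\<^sup>n\<close> has the form \<open>\<alpha> = x c M\<^sup>t\<close> with \<open>c < M\<close>. Then
  \<open>x M\<^sup>t\<^sup>+\<^sup>1\<close> is again a necklace, so the lexicographic successor of \<open>\<alpha>\<close> still starts with \<open>x\<close>.
  The concatenation \<open>U\<close> for the larger necklaces therefore starts with \<open>x\<close> and ends with \<open>M\<^sup>t\<close>, as
  does \<open>pr \<alpha>\<close> read cyclically: rotated by \<open>t\<close>, both start with the word \<open>M\<^sup>t x\<close> of length \<open>n - 1\<close>.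
  As \<open>\<alpha>\<close> has exactly \<open>|pr \<alpha>|\<close> windows and distinct necklaces share none, the length of the
  concatenation is the number of words covered, so each word occurs exactly once.\<close>

section \<open>Windows of cyclic words\<close>

lemma length_cyclic_window [simp]: "length (cyclic_window n w i) = n"
  by (simp add: cyclic_window_def)

lemma nth_cyclic_window [simp]:
  "j < n \<Longrightarrow> cyclic_window n w i ! j = w ! ((i + j) mod length w)"
  by (simp add: cyclic_window_def)

lemma cyclic_window_mod: "cyclic_window n w (i mod length w) = cyclic_window n w i"
  by (rule nth_equalityI) (simp_all add: mod_add_left_eq)

lemma take_drop_cyclic_window:
  "i + n \<le> l \<Longrightarrow> take n (drop i (cyclic_window l w j)) = cyclic_window n w (j + i)"
  by (rule nth_equalityI) (simp_all add: add.assoc)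

lemma take_cyclic_window: "m \<le> n \<Longrightarrow> take m (cyclic_window n w i) = cyclic_window m w i"
  using take_drop_cyclic_window[of 0 m n w i] by simp

lemma cyclic_window_0_eq_take: "n \<le> length w \<Longrightarrow> cyclic_window n w 0 = take n w"
  by (rule nth_equalityI) simp_all

lemma cyclic_window_add:
  "cyclic_window (m + n) w i = cyclic_window m w i @ cyclic_window n w (i + m)"
  by (rule nth_equalityI) (auto simp: nth_append add.assoc)

lemma cyclic_window_rotate:
  assumes "w \<noteq> []"
  shows "cyclic_window n (rotate k w) i = cyclic_window n w (k + i)"
  using assms by (intro nth_equalityI) (simp_all add: nth_rotate mod_add_right_eq add.assoc)

lemma cyclic_window_length: "cyclic_window (length w) w i = rotate i w"
  by (rule nth_equalityI) (simp_all add: nth_rotate)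

lemma cyclic_window_append_shift:
  assumes "u @ v \<noteq> []"
  shows "cyclic_window n (u @ v) (length u + i) = cyclic_window n (v @ u) i"
  using cyclic_window_rotate[OF assms, of n "length u" i] by (simp add: rotate_append)

lemma sub_conv_image: "sub n w = cyclic_window n w ` {..<length w}"
  by (auto simp: sub_def)

lemma sub_eq_range:
  assumes "w \<noteq> []"
  shows "sub n w = range (cyclic_window n w)"
proof
  show "range (cyclic_window n w) \<subseteq> sub n w"
  proof
    fix s assume "s \<in> range (cyclic_window n w)"
    then obtain i where "s = cyclic_window n w (i mod length w)" by (auto simp: cyclic_window_mod)
    then show "s \<in> sub n w" using assms by (simp add: sub_conv_image)
  qed
qed (auto simp: sub_conv_image)

lemma sub_append_commute: "sub n (u @ v) = sub n (v @ u)"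
proof -
  have "sub n (y @ x) \<subseteq> sub n (x @ y)" for x y :: "nat list"
  proof (cases "x @ y = []")
    case False
    then have "y @ x \<noteq> []" by auto
    then show ?thesis
      by (auto simp: sub_eq_range False simp flip: cyclic_window_append_shift[OF False])
  qed simp
  then show ?thesis by blast
qed

lemma sub_rotate: "sub n (rotate i w) = sub n w"
  unfolding rotate_drop_take by (subst sub_append_commute) simp

lemma sub_subset_strings:
  assumes "set w \<subseteq> {0..<k}"
  shows "sub n w \<subseteq> strings k n"
proof -
  have "w ! ((i + j) mod length w) \<in> {0..<k}" if "i < length w" for i j
    using that by (intro subsetD[OF assms] nth_mem mod_less_divisor) auto
  then show ?thesis by (auto simp: sub_def strings_def cyclic_window_def)
qed

lemma universal_cycle_sub:
  assumes "w \<noteq> []" "set w \<subseteq> {0..<k}" "length w = card (sub n w)"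
  shows "universal_cycle k n (sub n w) w"
proof -
  have "inj_on (cyclic_window n w) {..<length w}"
    using assms(3) by (intro eq_card_imp_inj_on) (simp_all add: sub_conv_image)
  then have "\<forall>s\<in>sub n w. \<exists>!i. i < length w \<and> cyclic_window n w i = s"
    by (auto simp: sub_conv_image inj_on_def)
  moreover have "sub n w \<noteq> {}" using assms(1) by (simp add: sub_conv_image lessThan_empty_iff)
  ultimately show ?thesis
    using assms sub_subset_strings by (simp add: universal_cycle_def)
qed

section \<open>Joining cyclic words\<close>

lemma nth_append_mod_agree:
  assumes "u \<noteq> []"
    and agree: "\<And>r. r < k \<Longrightarrow> u ! (r mod length u) = v ! (r mod length v)"
    and "r < length u + k"
  shows "(u @ v) ! (r mod length (u @ v)) = u ! (r mod length u)"
  using assms(3)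
proof (induction r rule: less_induct)
  case (less r)
  show ?case
  proof (cases "r < length u")
    case False
    let ?s = "r - length u"
    have "?s < k" using less.prems False by simp
    have "(u @ v) ! (r mod length (u @ v)) = v ! (?s mod length v)"
    proof (cases "r < length (u @ v)")
      case True
      then show ?thesis using False by (simp add: nth_append)
    next
      case wrapped: False
      let ?t = "r - length (u @ v)"
      have "?t < r" using wrapped assms(1) by (cases u) auto
      have "(u @ v) ! (r mod length (u @ v)) = (u @ v) ! (?t mod length (u @ v))"
        using wrapped by (simp add: le_mod_geq)
      also have "\<dots> = u ! (?t mod length u)" using less.IH[OF \<open>?t < r\<close>] less.prems by simp
      also have "\<dots> = v ! (?t mod length v)" using agree[of ?t] \<open>?s < k\<close> by simp
      also have "\<dots> = v ! (?s mod length v)" using wrapped by (simp add: le_mod_geq)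
      finally show ?thesis .
    qed
    also have "\<dots> = u ! (?s mod length u)" using agree[OF \<open>?s < k\<close>] by simp
    also have "\<dots> = u ! (r mod length u)" using False by (simp add: le_mod_geq)
    finally show ?thesis .
  qed (simp add: nth_append)
qed

lemma cyclic_window_append_agree:
  assumes "u \<noteq> []" and agree: "cyclic_window k u 0 = cyclic_window k v 0"
  shows "cyclic_window (length u + k) (u @ v) 0 = cyclic_window (length u + k) u 0"
proof -
  have "u ! (r mod length u) = v ! (r mod length v)" if "r < k" for r
    using arg_cong[OF agree, of "\<lambda>s. s ! r"] that by simp
  from nth_append_mod_agree[OF assms(1) this, of k] show ?thesis
    by (intro nth_equalityI) simp_all
qed

lemma sub_append:
  assumes "u \<noteq> []" "v \<noteq> []" and agree: "cyclic_window (n - 1) u 0 = cyclic_window (n - 1) v 0"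
  shows "sub n (u @ v) = sub n u \<union> sub n v"
proof -
  have left: "cyclic_window n (x @ y) i = cyclic_window n x i"
    if "x \<noteq> []" "cyclic_window (n - 1) x 0 = cyclic_window (n - 1) y 0" "i < length x" for x y i
  proof -
    have "i + n \<le> length x + (n - 1)" using that(3) by linarith
    then show ?thesis
      using cyclic_window_append_agree[OF that(1,2)] take_drop_cyclic_window[of i n _ _ 0]
      by (metis add_0)
  qed
  have right: "cyclic_window n (u @ v) (length u + i) = cyclic_window n v i" if "i < length v" for i
    using left[OF assms(2) agree[symmetric] that] assms(1) by (simp add: cyclic_window_append_shift)
  have "{..<length (u @ v)} = {..<length u} \<union> (+) (length u) ` {..<length v}"
    by (simp add: lessThan_atLeast0 ivl_disj_un_two(3) add.commute)
  then have "sub n (u @ v) = cyclic_window n (u @ v) ` {..<length u} \<union>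
      (\<lambda>i. cyclic_window n (u @ v) (length u + i)) ` {..<length v}"
    by (simp only: sub_conv_image image_Un image_image)
  also have "\<dots> = sub n u \<union> sub n v"
    using left[OF assms(1) agree] right by (simp add: sub_conv_image)
  finally show ?thesis .
qed

lemma sub_append_common_suffix:
  assumes "u @ p \<noteq> []" "v @ p \<noteq> []"
    and agree: "cyclic_window r (u @ p) 0 = cyclic_window r (v @ p) 0"
    and n: "n = Suc (length p + r)"
  shows "sub n ((u @ p) @ (v @ p)) = sub n (u @ p) \<union> sub n (v @ p)"
proof -
  have "cyclic_window (n - 1) (p @ y) 0 = p @ cyclic_window r (y @ p) 0" if "y @ p \<noteq> []" for y
  proof -
    have "p @ y \<noteq> []" using that by auto
    then show ?thesis
      using cyclic_window_append_shift[of p y r 0]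
      by (simp add: n cyclic_window_add cyclic_window_0_eq_take)
  qed
  then have "cyclic_window (n - 1) (p @ u) 0 = cyclic_window (n - 1) (p @ v) 0"
    using assms(1,2) agree by simp
  moreover have "sub n ((u @ p) @ (v @ p)) = sub n ((p @ u) @ (p @ v))"
    using sub_append_commute[of n "u @ p @ v" p] by simp
  moreover have "p @ u \<noteq> []" "p @ v \<noteq> []" using assms by auto
  ultimately show ?thesis
    using sub_append[of "p @ u" "p @ v" n] by (metis sub_append_commute)
qed

lemma sub_Cons_replicate:
  assumes "0 < n"
  shows "sub n (c # replicate n M) = sub n (c # replicate (n - 1) M) \<union> sub n [M]"
proof -
  obtain l where n: "n = Suc l" using assms gr0_implies_Suc by blast
  have const: "cyclic_window l [M] 0 = replicate l M" by (rule nth_equalityI) simp_all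
  have "sub n (c # replicate n M) = sub n ((replicate l M @ [c]) @ [M])"
    using sub_append_commute[of n "[c, M]" "replicate l M"] by (simp add: n)
  also have "\<dots> = sub n (replicate l M @ [c]) \<union> sub n [M]"
    by (rule sub_append) (simp_all add: n const cyclic_window_0_eq_take)
  also have "sub n (replicate l M @ [c]) = sub n (c # replicate (n - 1) M)"
    using sub_append_commute[of n "[c]" "replicate l M"] by (simp add: n)
  finally show ?thesis .
qed

section \<open>Periodic reduction\<close>

lemma pr_powerE:
  assumes "w \<noteq> []"
  obtains q where "0 < q" "w = concat (replicate q (pr w))" "pr w \<noteq> []"
proof -
  let ?Q = "\<lambda>p. 0 < p \<and> p dvd length w \<and> w = concat (replicate (length w div p) (take p w))"
  define p where "p = (LEAST p. ?Q p)"
  have "?Q (length w)" using assms by simp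
  then have "?Q p" unfolding p_def by (rule LeastI)
  moreover have "pr w = take p w" by (simp add: pr_def p_def)
  ultimately have power: "w = concat (replicate (length w div p) (pr w))" by presburger
  show ?thesis
  proof (rule that[OF _ power])
    show "0 < length w div p" using assms power by (metis concat.simps(1) gr0I replicate_0)
    show "pr w \<noteq> []" using assms power by (metis concat_replicate_trivial)
  qed
qed

lemma length_pr_le:
  assumes "w = concat (replicate q z)" "w \<noteq> []"
  shows "length (pr w) \<le> length z"
proof -
  have "z \<noteq> []" "0 < q" using assms by (auto intro: ccontr)
  then obtain q' where q: "q = Suc q'" by (cases q) auto
  have "length w = q * length z" by (simp add: assms(1) length_concat sum_list_replicate)
  moreover have "take (length z) w = z" using assms(1) q by simp
  ultimately have "0 < length z \<and> length z dvd length w \<and>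
      w = concat (replicate (length w div length z) (take (length z) w))"
    using assms(1) \<open>z \<noteq> []\<close> by simp
  then show ?thesis
    unfolding pr_def by (simp add: Least_le min.coboundedI2)
qed

lemma length_pr_le_rotation:
  assumes "rotate d w = w" "0 < d" "w \<noteq> []"
  shows "length (pr w) \<le> d"
proof (cases "d < length w")
  case True
  then have "take d w @ drop d w = drop d w @ take d w"
    using assms(1) by (simp add: rotate_drop_take)
  then obtain a b z where z: "concat (replicate a z) = take d w" "concat (replicate b z) = drop d w"
    using comm_append_are_replicate by blast
  then have "w = concat (replicate (a + b) z)" by (simp add: replicate_add)
  then have "length (pr w) \<le> length z" using assms(3) by (rule length_pr_le)
  also have "\<dots> \<le> length (concat (replicate a z))"
  proof (cases a)
    case 0
    then show ?thesis using z(1) assms(2,3) by simp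
  qed simp
  also have "\<dots> = d" unfolding z(1) using True by simp
  finally show ?thesis .
next
  case False
  then show ?thesis using length_pr_le[of w 1 w] assms(3) by simp
qed

lemma pr_nonempty: "w \<noteq> [] \<Longrightarrow> pr w \<noteq> []"
  by (rule pr_powerE)

lemma set_pr:
  assumes "w \<noteq> []"
  shows "set (pr w) = set w"
proof -
  obtain q where "0 < q" "w = concat (replicate q (pr w))" using pr_powerE[OF assms] by blast
  moreover have "set (concat (replicate q z)) = set z" if "0 < q" for q and z :: "nat list"
    using that by simp
  ultimately show ?thesis by metis
qed

lemma suffix_pr:
  assumes "w \<noteq> []"
  shows "suffix (pr w) w"
proof -
  obtain q where "0 < q" "w = concat (replicate q (pr w))" using pr_powerE[OF assms] by blast
  then have "w = concat (replicate (q - 1) (pr w)) @ pr w"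
    by (metis Suc_pred' append_Nil2 concat.simps concat_append replicate_Suc replicate_append_same)
  then show ?thesis by (rule suffixI)
qed

lemma pr_replicate:
  assumes "0 < n"
  shows "pr (replicate n M) = [M]"
proof -
  have "replicate n M \<noteq> []" using assms by simp
  then have "set (pr (replicate n M)) = {M}" using assms by (simp add: set_pr)
  moreover have "length (pr (replicate n M)) \<le> 1"
    using length_pr_le[of "replicate n M" n "[M]"] assms by simp
  ultimately show ?thesis by (cases "pr (replicate n M)") auto
qed

lemma pr_trailing_replicateE:
  assumes "w = x @ c # replicate t M" "c \<noteq> M"
  obtains u where "u \<noteq> []" "pr w = u @ replicate t M"
proof -
  have "w \<noteq> []" "c \<in> set (pr w)" using assms by (auto simp: set_pr)
  have "suffix (replicate t M) w" unfolding assms(1) by (auto intro: suffix_appendI suffix_ConsI)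
  then have "suffix (pr w) (replicate t M) \<or> suffix (replicate t M) (pr w)"
    using suffix_pr[OF \<open>w \<noteq> []\<close>] suffix_same_cases by blast
  moreover have not_suffix: "\<not> suffix (pr w) (replicate t M)"
    using \<open>c \<in> set (pr w)\<close> \<open>c \<noteq> M\<close> by (metis in_set_replicate set_mono_suffix subsetD)
  ultimately obtain u where u: "pr w = u @ replicate t M" by (blast elim: suffixE)
  moreover from u have "u \<noteq> []" using not_suffix by auto
  ultimately show ?thesis using that by blast
qed

lemma cyclic_window_concat_replicate:
  assumes "z \<noteq> []" "0 < q"
  shows "cyclic_window n (concat (replicate q z)) i = cyclic_window n z i"
  using assms(2)
proof (induction q arbitrary: n i rule: nat_induct_non_zero)
  case (Suc q)
  let ?z = "concat (replicate q z)"
  let ?l = "length z + (i + n)"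
  have "cyclic_window ?l (z @ ?z) 0 = cyclic_window ?l z 0"
    using assms(1) Suc by (intro cyclic_window_append_agree) auto
  then show ?case
    using take_drop_cyclic_window[of i n ?l _ 0]
    by (metis add_0 concat.simps(2) le_add2 replicate_Suc)
qed simp

lemma cyclic_window_pr:
  assumes "w \<noteq> []"
  shows "cyclic_window n (pr w) i = cyclic_window n w i"
proof -
  obtain q where "0 < q" and q: "w = concat (replicate q (pr w))" "pr w \<noteq> []"
    using pr_powerE[OF assms] by blast
  then have "cyclic_window n (pr w) i = cyclic_window n (concat (replicate q (pr w))) i"
    by (intro cyclic_window_concat_replicate[symmetric])
  also have "\<dots> = cyclic_window n w i" by (simp only: q(1)[symmetric])
  finally show ?thesis .
qed

lemma sub_pr:
  assumes "w \<noteq> []"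
  shows "sub n (pr w) = sub n w"
proof -
  have "cyclic_window n (pr w) = cyclic_window n w"
    by (rule ext) (rule cyclic_window_pr[OF assms])
  then show ?thesis using assms pr_nonempty by (simp add: sub_eq_range)
qed

lemma card_sub:
  assumes "w \<noteq> []"
  shows "card (sub (length w) w) = length (pr w)"
proof -
  have "inj_on (cyclic_window (length w) (pr w)) {..<length (pr w)}"
  proof (rule linorder_inj_onI')
    fix i j
    assume "j \<in> {..<length (pr w)}" "i < j"
    show "cyclic_window (length w) (pr w) i \<noteq> cyclic_window (length w) (pr w) j"
    proof
      assume "cyclic_window (length w) (pr w) i = cyclic_window (length w) (pr w) j"
      then have "rotate i w = rotate i (rotate (j - i) w)"
        using \<open>i < j\<close> by (simp add: cyclic_window_pr[OF assms] cyclic_window_length rotate_rotate)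
      then have "rotate (j - i) w = w"
        by (metis inj_fn[OF inj_rotate1] injD rotate_def)
      then have "length (pr w) \<le> j - i"
        using \<open>i < j\<close> assms by (intro length_pr_le_rotation) auto
      then show False using \<open>j \<in> {..<length (pr w)}\<close> \<open>i < j\<close> by simp
    qed
  qed
  then show ?thesis by (metis card_image card_lessThan sub_conv_image sub_pr[OF assms])
qed

section \<open>Necklaces\<close>

lemma take_mono_lexorder:
  fixes u v :: "'a :: linorder list"
  shows "u \<le> v \<Longrightarrow> take m u \<le> take m v"
proof (induction m arbitrary: u v)
  case (Suc m)
  then show ?case by (cases u; cases v) auto
qed simp

lemma necklaceI:
  assumes "\<And>y z. w = y @ z \<Longrightarrow> w \<le> z @ y"
  shows "necklace w"
  unfolding necklace_def rotate_drop_take by (simp add: assms)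

lemma necklaceD: "necklace (y @ z) \<Longrightarrow> y @ z \<le> z @ y"
  unfolding necklace_def by (metis rotate_append)

lemma necklace_eq_Min_sub:
  assumes "necklace w" "w \<noteq> []"
  shows "w = Min (sub (length w) w)"
proof (rule Min_eqI[symmetric])
  show "finite (sub (length w) w)" by (simp add: sub_conv_image)
  show "w \<le> s" if "s \<in> sub (length w) w" for s
    using that assms(1) by (auto simp: sub_conv_image cyclic_window_length necklace_def)
  show "w \<in> sub (length w) w"
    using assms(2) cyclic_window_length[of w 0] by (force simp: sub_conv_image)
qed

lemma sub_necklaces_disjoint:
  assumes "necklace v" "necklace w" "length v = n" "length w = n" "v \<noteq> w"
  shows "sub n v \<inter> sub n w = {}"
proof (rule ccontr)
  assume "sub n v \<inter> sub n w \<noteq> {}"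
  then obtain i j where "rotate i v = rotate j w"
    using cyclic_window_length[of v] cyclic_window_length[of w] assms(3,4)
    by (auto simp: sub_conv_image)
  then have "sub n v = sub n w" by (metis sub_rotate)
  moreover have "v \<noteq> []" "w \<noteq> []" using assms by auto
  ultimately show False using assms necklace_eq_Min_sub by metis
qed

lemma necklace_replicate: "necklace (replicate n M)"
proof -
  have "rotate i (replicate n M) = replicate n M" for i by (intro replicate_eqI) auto
  then show ?thesis by (simp add: necklace_def)
qed

lemma necklace_raise_tail:
  assumes neck: "necklace (x @ c # replicate t M)" and "c < M"
  shows "necklace (x @ replicate (Suc t) M)"
proof (rule necklaceI)
  let ?w = "x @ replicate (Suc t) M"
  fix y z assume yz: "?w = y @ z"
  show "?w \<le> z @ y"
  proof (cases "x = [] \<or> y = [] \<or> z = []")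
    case True
    then show ?thesis
      using yz necklace_replicate[of "Suc t" M] by (auto dest: necklaceD simp del: replicate_Suc)
  next
    case False
    define x\<^sub>1 x\<^sub>2 where "x\<^sub>1 = take (length y) x" and "x\<^sub>2 = drop (length y) x"
    \<comment> \<open>Raising \<open>c\<close> to \<open>M\<close> keeps the first \<open>?m\<close> letters of the word but increases letter \<open>?m\<close> of its
      rotation \<open>z @ y\<close>.\<close>
    let ?m = "Suc (length x\<^sub>2)"
    have x: "x = x\<^sub>1 @ x\<^sub>2" by (simp add: x\<^sub>1_def x\<^sub>2_def)
    have "?m \<le> length x" using False by (simp add: x\<^sub>2_def Suc_le_eq)
    have "z = drop (length y) ?w" by (simp add: yz del: replicate_Suc)
    also have "\<dots> = x\<^sub>2 @ replicate (Suc t - (length y - length x)) M"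
      by (simp only: x\<^sub>2_def drop_append drop_replicate)
    also have "Suc t - (length y - length x) = Suc (t - (length y - length x))"
      using arg_cong[OF yz, of length] False by (cases z) auto
    finally have z: "take ?m (z @ y) = x\<^sub>2 @ [M]" by simp
    have "x @ c # replicate t M \<le> (x\<^sub>2 @ c # replicate t M) @ x\<^sub>1"
      using necklaceD[of x\<^sub>1 "x\<^sub>2 @ c # replicate t M"] neck x by simp
    from take_mono_lexorder[OF this, of ?m]
    have "take ?m ?w \<le> x\<^sub>2 @ [c]" using \<open>?m \<le> length x\<close> by simp
    also have "\<dots> < take ?m (z @ y)" unfolding z using \<open>c < M\<close> by (induction x\<^sub>2) auto
    finally show ?thesis using take_mono_lexorder by (meson linear not_le)
  qed
qed

lemma Neck_Suc_iff: "w \<in> Neck (Suc M) n \<longleftrightarrow> length w = n \<and> set w \<subseteq> {..M} \<and> necklace w"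
  by (auto simp: Neck_def strings_def less_Suc_eq_le)

lemma replicate_in_Neck: "replicate n M \<in> Neck (Suc M) n"
  by (auto simp: Neck_Suc_iff necklace_replicate)

lemma Neck_le_replicate:
  assumes "w \<in> Neck (Suc M) n"
  shows "w \<le> replicate n M"
proof -
  have "set v \<subseteq> {..M} \<Longrightarrow> v \<le> replicate (length v) M" for v :: "nat list"
    by (induction v) auto
  then show ?thesis using assms by (auto simp: Neck_Suc_iff)
qed

lemma Neck_trailing_replicateE:
  assumes "w \<in> Neck (Suc M) n" "w \<noteq> replicate n M"
  obtains x c t where "w = x @ c # replicate t M" "c < M" "n = Suc (t + length x)"
    "x @ replicate (Suc t) M \<in> Neck (Suc M) n"
proof -
  have "\<exists>a\<in>set w. a \<noteq> M"
    using assms by (metis (mono_tags) Neck_Suc_iff replicate_length_same)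
  then obtain x c s where "w = x @ c # s" "c \<noteq> M" "\<forall>a\<in>set s. a = M"
    by (elim split_list_last_propE) auto
  then have w: "w = x @ c # replicate (length s) M" by (simp add: replicate_length_same)
  have "c < M" using assms(1) w \<open>c \<noteq> M\<close> by (auto simp: Neck_Suc_iff)
  moreover have "x @ replicate (Suc (length s)) M \<in> Neck (Suc M) n"
    using assms(1) necklace_raise_tail[of x c "length s" M] w \<open>c < M\<close>
    by (auto simp: Neck_Suc_iff)
  moreover have "n = Suc (length s + length x)"
    using assms(1) w by (auto simp: Neck_Suc_iff dest: arg_cong[of _ _ length])
  ultimately show ?thesis using that w by blast
qed

section \<open>The last necklaces in lexicographic order\<close>

definition final_necklaces :: "nat \<Rightarrow> nat \<Rightarrow> nat list list \<Rightarrow> bool" where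
  "final_necklaces k n ws \<longleftrightarrow> suffix ws (sorted_list_of_set (Neck k n))"

lemma final_necklaces_ConsD: "final_necklaces k n (w # ws) \<Longrightarrow> final_necklaces k n ws"
  unfolding final_necklaces_def by (rule suffix_ConsD)

lemma set_final_necklaces_subset: "final_necklaces k n ws \<Longrightarrow> set ws \<subseteq> Neck k n"
  unfolding final_necklaces_def by (metis finite_Neck set_mono_suffix set_sorted_list_of_set)

lemma distinct_final_necklaces: "final_necklaces k n ws \<Longrightarrow> distinct ws"
  unfolding final_necklaces_def by (metis distinct_append distinct_sorted_list_of_set suffixE)

lemma set_final_necklaces_Cons:
  assumes "final_necklaces k n (v # ws)"
  shows "set ws = {w \<in> Neck k n. v < w}"
proof -
  obtain us where us: "sorted_list_of_set (Neck k n) = us @ v # ws"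
    using assms by (auto simp: final_necklaces_def elim: suffixE)
  have "set (us @ v # ws) = Neck k n" "sorted_wrt (<) (us @ v # ws)"
    using finite_Neck[of k n] by (simp_all flip: us)
  then show ?thesis by (force simp: sorted_wrt_append)
qed

lemma final_necklaces_successor_le:
  assumes "final_necklaces k n (v # w # ws)" "u \<in> Neck k n" "v < u"
  shows "w \<le> u"
  using assms set_final_necklaces_Cons[OF assms(1)]
    set_final_necklaces_Cons[OF final_necklaces_ConsD[OF assms(1)]] by auto

lemma final_necklaces_singleton:
  assumes "final_necklaces (Suc M) n [w]"
  shows "w = replicate n M"
proof -
  have "w \<in> Neck (Suc M) n" using set_final_necklaces_subset[OF assms] by simp
  then have "w \<le> replicate n M" by (rule Neck_le_replicate)
  moreover have "\<not> w < replicate n M"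
    using set_final_necklaces_Cons[OF assms] replicate_in_Neck by auto
  ultimately show ?thesis by simp
qed

lemma final_necklaces_successorE:
  assumes "final_necklaces (Suc M) n (v # w # ws)"
  obtains x c t where "v = x @ c # replicate t M" "c < M" "n = Suc (t + length x)"
    "take (length x) w = x"
proof -
  have v: "v \<in> Neck (Suc M) n" and w: "w \<in> Neck (Suc M) n" and "v < w"
    using set_final_necklaces_subset[OF assms] set_final_necklaces_Cons[OF assms] by auto
  then have "v \<noteq> replicate n M" using Neck_le_replicate[OF w] by auto
  then obtain x c t where v_eq: "v = x @ c # replicate t M" "c < M" and n: "n = Suc (t + length x)"
    and raised: "x @ replicate (Suc t) M \<in> Neck (Suc M) n"
    using Neck_trailing_replicateE[OF v] by blast
  have "v < x @ replicate (Suc t) M" unfolding v_eq(1) using \<open>c < M\<close> by (induction x) auto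
  then have "w \<le> x @ replicate (Suc t) M"
    using final_necklaces_successor_le[OF assms raised] by blast
  from take_mono_lexorder[OF this, of "length x"] take_mono_lexorder[of v w "length x"]
  have "take (length x) w = x" using \<open>v < w\<close> v_eq(1) by simp
  then show ?thesis using that v_eq n by blast
qed

lemma final_necklaces_pr_prefixE:
  assumes "final_necklaces (Suc M) n (v # w # ws)"
  obtains u t r where "n = Suc (t + r)" "u \<noteq> []" "pr v = u @ replicate t M"
    "cyclic_window r (pr v) 0 = take r w"
proof -
  obtain x c t where v: "v = x @ c # replicate t M" "c < M" and n: "n = Suc (t + length x)"
    and x: "take (length x) w = x"
    using assms by (rule final_necklaces_successorE)
  obtain u where u: "u \<noteq> []" "pr v = u @ replicate t M"
    using pr_trailing_replicateE[OF v(1)] \<open>c < M\<close> by blast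
  have "v \<noteq> []" using v(1) by simp
  have "cyclic_window (length x) (pr v) 0 = take (length x) w"
    unfolding cyclic_window_pr[OF \<open>v \<noteq> []\<close>] x by (simp add: v(1) cyclic_window_0_eq_take)
  then show ?thesis using that n u by blast
qed

section \<open>Concatenation of the last necklaces\<close>

lemma UC_Cons: "UC (w # ws) = pr w @ UC ws"
  by (simp add: UC_def)

lemma UC_nonempty:
  assumes "ws \<noteq> []" "[] \<notin> set ws"
  shows "UC ws \<noteq> []"
  using assms by (cases ws) (auto simp: UC_Cons pr_nonempty)

lemma set_UC:
  assumes "[] \<notin> set ws"
  shows "set (UC ws) = (\<Union>w\<in>set ws. set w)"
proof -
  have "set (pr w) = set w" if "w \<in> set ws" for w using assms that by (metis set_pr)
  then show ?thesis by (simp add: UC_def)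
qed

lemma UC_last_two_necklacesE:
  assumes "final_necklaces (Suc M) n [v, w]"
  obtains c where "v = c # replicate (n - 1) M" "w = replicate n M" "UC [v, w] = c # replicate n M"
proof -
  have w: "w = replicate n M"
    by (rule final_necklaces_singleton[OF final_necklaces_ConsD[OF assms]])
  obtain x c t where v: "v = x @ c # replicate t M" "c < M" and n: "n = Suc (t + length x)"
    and x: "take (length x) w = x"
    using assms by (rule final_necklaces_successorE)
  have "necklace v" using set_final_necklaces_subset[OF assms] by (simp add: Neck_Suc_iff)
  then have "x @ c # replicate t M \<le> (c # replicate t M) @ x"
    unfolding v(1) by (rule necklaceD)
  moreover have "x = replicate (length x) M"
    using x unfolding w by (metis length_replicate take_replicate)
  ultimately have "x = []" using \<open>c < M\<close> by (cases x) auto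
  then have v': "v = c # replicate (n - 1) M" using v(1) n by simp
  obtain u where "u \<noteq> []" "pr v = u @ replicate t M"
    using pr_trailing_replicateE[OF v(1)] \<open>c < M\<close> by blast
  moreover have "suffix (pr v) v" using v(1) by (intro suffix_pr) simp
  ultimately have "pr v = v"
    using v(1) \<open>x = []\<close> by (auto simp: suffix_def Cons_eq_append_conv)
  then have "UC [v, w] = c # replicate n M"
    using v' n w by (simp add: UC_def pr_replicate replicate_append_same flip: replicate_Suc)
  then show ?thesis using that v' w by blast
qed

lemma suffix_replicate_UC:
  assumes "final_necklaces (Suc M) n (v # w # ws)"
  shows "suffix (replicate n M) (UC (v # w # ws))"
  using assms
proof (induction ws arbitrary: v w)
  case Nil
  then show ?case
    by (auto elim!: UC_last_two_necklacesE intro: suffix_ConsI simp del: replicate_Suc)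
next
  case (Cons u ws)
  then have "suffix (replicate n M) (UC (w # u # ws))" by (blast dest: final_necklaces_ConsD)
  then show ?case by (simp add: UC_Cons suffix_appendI)
qed

lemma UC_final_necklaces_nonempty:
  assumes "final_necklaces k n ws" "ws \<noteq> []" "0 < n"
  shows "UC ws \<noteq> []"
  using assms set_final_necklaces_subset[OF assms(1)]
  by (intro UC_nonempty) (auto simp: Neck_def strings_def)

lemma UC_prefix:
  assumes "final_necklaces (Suc M) n (w # ws)" "0 < n"
  shows "cyclic_window n (UC (w # ws)) 0 = w"
  using assms(1)
proof (induction ws arbitrary: w)
  case Nil
  then show ?case
    using assms(2)
    by (auto dest!: final_necklaces_singleton simp: UC_def pr_replicate intro!: nth_equalityI)
next
  case (Cons v ws)
  let ?U = "UC (v # ws)"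
  obtain u t r where n: "n = Suc (t + r)" and u: "u \<noteq> []" "pr w = u @ replicate t M"
    and prefix: "cyclic_window r (pr w) 0 = take r v"
    using Cons.prems by (rule final_necklaces_pr_prefixE)
  have tail: "final_necklaces (Suc M) n (v # ws)" using Cons.prems by (rule final_necklaces_ConsD)
  have "length w = n" using set_final_necklaces_subset[OF Cons.prems] by (simp add: Neck_Suc_iff)
  have "w \<noteq> []" using \<open>length w = n\<close> assms(2) by auto
  have "n \<le> length (pr w) + r" using u n by (simp add: Suc_le_eq)
  have "cyclic_window r (pr w) 0 = cyclic_window r ?U 0"
    using Cons.IH[OF tail] prefix n take_cyclic_window[of r n ?U 0] by simp
  then have "cyclic_window (length (pr w) + r) (pr w @ ?U) 0 =
      cyclic_window (length (pr w) + r) (pr w) 0"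
    using u by (intro cyclic_window_append_agree) auto
  then have "cyclic_window n (pr w @ ?U) 0 = cyclic_window n (pr w) 0"
    using take_cyclic_window[OF \<open>n \<le> length (pr w) + r\<close>] by metis
  also have "\<dots> = w"
    using \<open>length w = n\<close> cyclic_window_pr[OF \<open>w \<noteq> []\<close>] by (simp add: cyclic_window_0_eq_take)
  finally show ?case by (simp add: UC_Cons)
qed

lemma sub_UC_final_necklaces:
  assumes "final_necklaces (Suc M) n (w # ws)" "0 < n"
  shows "sub n (UC (w # ws)) = (\<Union>v\<in>set (w # ws). sub n v)"
  using assms(1)
proof (induction ws arbitrary: w)
  case Nil
  then have "w \<noteq> []" using assms(2) by (auto dest!: final_necklaces_singleton)
  then show ?case by (simp add: UC_def sub_pr)
next
  case (Cons v ws)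
  let ?U = "UC (v # ws)"
  obtain u t r where n: "n = Suc (t + r)" and u: "u \<noteq> []" "pr w = u @ replicate t M"
    and prefix: "cyclic_window r (pr w) 0 = take r v"
    using Cons.prems by (rule final_necklaces_pr_prefixE)
  have tail: "final_necklaces (Suc M) n (v # ws)" using Cons.prems by (rule final_necklaces_ConsD)
  have "w \<in> Neck (Suc M) n" using set_final_necklaces_subset[OF Cons.prems] by simp
  then have "w \<noteq> []" using assms(2) by (auto simp: Neck_Suc_iff)
  have "sub n (UC (w # v # ws)) = sub n w \<union> sub n ?U"
  proof (cases ws)
    case Nil \<comment> \<open>\<open>?U\<close> is the single letter \<open>M\<close>, which ends in \<open>M\<^sup>t\<close> only when read cyclically.\<close>
    obtain c where "w = c # replicate (n - 1) M" "v = replicate n M" "UC [w, v] = c # replicate n M"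
      using Cons.prems UC_last_two_necklacesE unfolding Nil by blast
    then show ?thesis
      using sub_Cons_replicate[OF assms(2), of c M] assms(2) Nil by (simp add: UC_def pr_replicate)
  next
    case (Cons y ys)
    have "suffix (replicate t M) (replicate n M)"
      by (rule suffixI[of _ "replicate (Suc r) M"]) (simp add: n flip: replicate_add)
    also have "suffix (replicate n M) ?U"
      using tail unfolding Cons by (rule suffix_replicate_UC)
    finally obtain u' where u': "?U = u' @ replicate t M" by (rule suffixE)
    have "cyclic_window r (pr w) 0 = cyclic_window r ?U 0"
      using UC_prefix[OF tail assms(2)] prefix n take_cyclic_window[of r n ?U 0] by simp
    moreover have "?U \<noteq> []" using UC_final_necklaces_nonempty[OF tail _ assms(2)] by simp
    ultimately have "sub n (pr w @ ?U) = sub n (pr w) \<union> sub n ?U"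
      using sub_append_common_suffix[of u "replicate t M" u' r n] u u' n by simp
    then show ?thesis using \<open>w \<noteq> []\<close> by (simp add: UC_Cons[of w] sub_pr)
  qed
  then show ?case using Cons.IH[OF tail] by simp
qed

lemma length_UC:
  assumes "distinct ws" "set ws \<subseteq> Neck k n" "0 < n"
  shows "length (UC ws) = card (\<Union>w\<in>set ws. sub n w)"
proof -
  have "length (UC ws) = (\<Sum>w\<in>set ws. length (pr w))"
    using assms(1) by (simp add: UC_def length_concat comp_def sum_list_distinct_conv_sum_set)
  also have "\<dots> = (\<Sum>w\<in>set ws. card (sub n w))"
  proof (rule sum.cong[OF refl])
    fix w assume "w \<in> set ws"
    then have "length w = n" "w \<noteq> []" using assms(2,3) by (auto simp: Neck_def strings_def)
    then show "length (pr w) = card (sub n w)" using card_sub by metis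
  qed
  also have "\<dots> = card (\<Union>w\<in>set ws. sub n w)"
  proof (rule card_UN_disjoint[symmetric])
    show "\<forall>w\<in>set ws. finite (sub n w)" by (simp add: sub_conv_image)
    show "\<forall>v\<in>set ws. \<forall>w\<in>set ws. v \<noteq> w \<longrightarrow> sub n v \<inter> sub n w = {}"
      using assms(2) sub_necklaces_disjoint unfolding Neck_def strings_def by blast
  qed simp
  finally show ?thesis .
qed

lemma universal_cycle_UC:
  assumes "final_necklaces k n ws" "ws \<noteq> []" "0 < n"
  shows "universal_cycle k n (\<Union>w\<in>set ws. sub n w) (UC ws)"
proof -
  have in_Neck: "set ws \<subseteq> Neck k n" using assms(1) by (rule set_final_necklaces_subset)
  obtain w ws' where ws: "ws = w # ws'" using assms(2) by (cases ws) auto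
  then have "w \<in> strings k n" using in_Neck by (simp add: Neck_def)
  then obtain M where k: "k = Suc M" using assms(3) by (cases k) (auto simp: strings_def)
  have sub: "sub n (UC ws) = (\<Union>w\<in>set ws. sub n w)"
    using sub_UC_final_necklaces[of M n w ws'] assms(1,3) by (simp add: ws k)
  have "set (UC ws) \<subseteq> {0..<k}"
    using in_Neck assms(3) by (subst set_UC) (auto simp: Neck_def strings_def)
  moreover have "length (UC ws) = card (sub n (UC ws))"
    unfolding sub using distinct_final_necklaces[OF assms(1)] in_Neck assms(3) by (rule length_UC)
  ultimately show ?thesis
    using universal_cycle_sub UC_final_necklaces_nonempty[OF assms] by (metis sub)
qed

theorem theorem2:
  fixes k n m :: nat and \<alpha>s :: "nat list list"
  assumes "k \<ge> 2" and "n \<ge> 2" and "2 \<le> m" and "m \<le> card (Neck k n)"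
    and "\<alpha>s = drop (card (Neck k n) - m) (sorted_list_of_set (Neck k n))"
  shows "universal_cycle k n (\<Union>\<alpha>\<in>set \<alpha>s. sub n \<alpha>) (UC \<alpha>s)"
proof (rule universal_cycle_UC)
  show "final_necklaces k n \<alpha>s"
    unfolding final_necklaces_def assms(5) by (rule suffix_drop)
  show "\<alpha>s \<noteq> []" "0 < n" using assms by auto
qed

end
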